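(* Let $d,t$ be positive integers. If $X\subseteq\mathrm{U}(d)$ is a unitary $t$-design, then \[ |X| \geq \dim \mathrm{Hom}_{\mathrm{U}(d)}(\lceil t/2 \rceil,\lfloor t/2 \rfloor). \]
   Context: $\mathrm{U}(d)$ is the group of $d\times d$ complex unitary matrices and $dU$ the Haar measure on it normalized so that $\int_{\mathrm{U}(d)}dU=1$. A finite subset $X\subseteq \mathrm{U}(d)$ is a unitary $t$-design if \[ \frac{1}{|X|}\sum_{U\in X} U^{\otimes t}\otimes (U^* )^{\otimes t} = \int_{\mathrm{U}(d)} U^{\otimes t}\otimes (U^* )^{\otimes t}\,dU . \] For nonnegative integers $r,s$, $\mathrm{Hom}_{\mathrm{U}(d)}(r,s)$ denotes the complex vector space of functions on $\mathrm{U}(d)$ given by polynomials that are homogeneous of degree $r$ in the matrix entries of $U$ and homogeneous of degree $s$ in the matrix entries of $U^*$. (Equivalently, $X$ is a $t$-design iff $\frac{1}{|X|}\sum_{U\in X}f(U)=\int f(U)\,dU$ for every $f\in\mathrm{Hom}_{\mathrm{U}(d)}(t,t)$.) *)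

theory Defs
  imports "HOL-Analysis.Analysis" "HOL-Library.Function_Algebras"
begin

text \<open>Throughout, \<open>d = CARD('n)\<close>, so \<open>complex^'n^'n\<close> is the space of \<open>d \<times> d\<close> complex matrices.\<close>

definition cadjoint :: "complex^'n^'n \<Rightarrow> complex^'n^'n" where
  "cadjoint A = (\<chi> i j. cnj (A $ j $ i))"

definition unitary_group :: "(complex^'n^'n) set" where
  "unitary_group = {U. U ** cadjoint U = mat 1 \<and> cadjoint U ** U = mat 1}"

text \<open>The normalized Haar measure is the unique left-invariant Borel probability measure on the
  group.  Inner and outer regularity hold automatically for finite Borel measures on a compact
  metric space, so they are not listed.\<close>

definition normalized_haar :: "(complex^'n^'n) measure \<Rightarrow> bool" where
  "normalized_haar \<mu> \<longleftrightarrow>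
     space \<mu> = unitary_group \<and>
     sets \<mu> = sets (restrict_space borel unitary_group) \<and>
     emeasure \<mu> (space \<mu>) = 1 \<and>
     (\<forall>V\<in>unitary_group. distr \<mu> \<mu> (\<lambda>U. V ** U) = \<mu>)"

text \<open>Tensor products are Kronecker products.  The rows and columns of the \<open>t\<close>-fold tensor power are
  indexed by \<open>t\<close>-tuples, represented by lists of length \<open>t\<close>.\<close>

definition tensor_index :: "nat \<Rightarrow> 'n list set" where
  "tensor_index t = {I. length I = t}"

definition tensor_power :: "nat \<Rightarrow> complex^'n^'n \<Rightarrow> 'n list \<Rightarrow> 'n list \<Rightarrow> complex" where
  "tensor_power t A I J = (\<Prod>k<t. A $ (I ! k) $ (J ! k))"

definition tensor_prod ::
    "('a \<Rightarrow> 'a \<Rightarrow> complex) \<Rightarrow> ('b \<Rightarrow> 'b \<Rightarrow> complex) \<Rightarrow> 'a \<times> 'b \<Rightarrow> 'a \<times> 'b \<Rightarrow> complex" where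
  "tensor_prod A B p q = A (fst p) (fst q) * B (snd p) (snd q)"

text \<open>The equality of matrices, and the integral of a matrix-valued function, are entrywise.\<close>

definition unitary_design :: "(complex^'n^'n) measure \<Rightarrow> nat \<Rightarrow> (complex^'n^'n) set \<Rightarrow> bool" where
  "unitary_design \<mu> t X \<longleftrightarrow>
     finite X \<and> X \<noteq> {} \<and> X \<subseteq> unitary_group \<and>
     (\<forall>p \<in> tensor_index t \<times> tensor_index t. \<forall>q \<in> tensor_index t \<times> tensor_index t.
        1 / of_nat (card X) *
          (\<Sum>U\<in>X. tensor_prod (tensor_power t U) (tensor_power t (cadjoint U)) p q)
        = (\<integral>U. tensor_prod (tensor_power t U) (tensor_power t (cadjoint U)) p q \<partial>\<mu>))"

text \<open>Exponents of the monomials of degree \<open>r\<close> in the \<open>d\<^sup>2\<close> entries of a matrix.\<close>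

definition exponents :: "nat \<Rightarrow> ('n::finite \<times> 'n \<Rightarrow> nat) set" where
  "exponents r = {a. (\<Sum>ij\<in>UNIV. a ij) = r}"

lemma finite_exponents: "finite (exponents r)"
proof (rule finite_subset)
  show "exponents r \<subseteq> PiE UNIV (\<lambda>_. {..r})"
    by (auto simp: exponents_def PiE_def intro: member_le_sum)
  show "finite (PiE (UNIV :: ('a \<times> 'a) set) (\<lambda>_. {..r}))"
    by (intro finite_PiE) auto
qed

definition entry_monomial :: "('n \<times> 'n \<Rightarrow> nat) \<Rightarrow> complex^'n^'n \<Rightarrow> complex" where
  "entry_monomial a A = (\<Prod>(i, j)\<in>UNIV. (A $ i $ j) ^ a (i, j))"

text \<open>Functions on the unitary group are represented by functions on all matrices that vanish off
  the group.  Thus polynomials that agree on the group give the same element.\<close>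

definition unitary_Hom :: "nat \<Rightarrow> nat \<Rightarrow> (complex^'n^'n \<Rightarrow> complex) set" where
  "unitary_Hom r s =
     {f. \<exists>c :: ('n \<times> 'n \<Rightarrow> nat) \<Rightarrow> ('n \<times> 'n \<Rightarrow> nat) \<Rightarrow> complex. \<forall>U.
        f U = (if U \<in> unitary_group
               then \<Sum>a\<in>exponents r. \<Sum>b\<in>exponents s.
                      c a b * entry_monomial a U * entry_monomial b (cadjoint U)
               else 0)}"

definition cfun_scale :: "complex \<Rightarrow> ('a \<Rightarrow> complex) \<Rightarrow> 'a \<Rightarrow> complex" where
  "cfun_scale c f = (\<lambda>x. c * f x)"

interpretation cfun: vector_space cfun_scale
  by unfold_locales (auto simp: cfun_scale_def fun_eq_iff algebra_simps)

lemma subspace_unitary_Hom: "cfun.subspace (unitary_Hom r s)"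
proof (rule cfun.subspaceI)
  show "0 \<in> unitary_Hom r s"
    unfolding unitary_Hom_def by (auto intro!: exI[of _ "\<lambda>_ _. 0"])
next
  fix f g :: "complex^'n^'n \<Rightarrow> complex"
  assume "f \<in> unitary_Hom r s" "g \<in> unitary_Hom r s"
  then obtain c e where
    "\<forall>U. f U = (if U \<in> unitary_group then \<Sum>a\<in>exponents r. \<Sum>b\<in>exponents s.
         c a b * entry_monomial a U * entry_monomial b (cadjoint U) else 0)"
    "\<forall>U. g U = (if U \<in> unitary_group then \<Sum>a\<in>exponents r. \<Sum>b\<in>exponents s.
         e a b * entry_monomial a U * entry_monomial b (cadjoint U) else 0)"
    unfolding unitary_Hom_def by blast
  then show "f + g \<in> unitary_Hom r s"
    unfolding unitary_Hom_def
    by (auto intro!: exI[of _ "\<lambda>a b. c a b + e a b"] simp: sum.distrib distrib_right)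
next
  fix k and f :: "complex^'n^'n \<Rightarrow> complex"
  assume "f \<in> unitary_Hom r s"
  then obtain c where
    "\<forall>U. f U = (if U \<in> unitary_group then \<Sum>a\<in>exponents r. \<Sum>b\<in>exponents s.
         c a b * entry_monomial a U * entry_monomial b (cadjoint U) else 0)"
    unfolding unitary_Hom_def by blast
  then show "cfun_scale k f \<in> unitary_Hom r s"
    unfolding unitary_Hom_def
    by (auto intro!: exI[of _ "\<lambda>a b. k * c a b"]
        simp: cfun_scale_def sum_distrib_left mult.assoc)
qed

end

theory Submission
  imports Defs
begin

text \<open>Restriction to \<open>X\<close> is injective on \<open>Hom(r, s)\<close> when \<open>r + s = t\<close>: if \<open>f\<close> vanishes on \<open>X\<close>, then
  \<open>\<bar>f\<bar>\<^sup>2\<close> lies in \<open>Hom(t, t)\<close>, so by the design property its Haar integral is its average over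
  \<open>X\<close>, which is zero. As \<open>f\<close> is continuous and Haar measure charges every nonempty open set, \<open>f\<close> is zero.
  Hence \<open>Hom(r, s)\<close> embeds in the \<open>card X\<close>-dimensional space of functions on \<open>X\<close>.\<close>

section \<open>The space of functions as a span of monomials\<close>

text \<open>The value zero off the group follows the convention of \<open>unitary_Hom\<close>, so
  that these functions are themselves elements of it and span it.\<close>

definition unitary_monomial ::
    "('n::finite \<times> 'n \<Rightarrow> nat) \<Rightarrow> ('n \<times> 'n \<Rightarrow> nat) \<Rightarrow> complex^'n^'n \<Rightarrow> complex" where
  "unitary_monomial a b U =
     (if U \<in> unitary_group then entry_monomial a U * entry_monomial b (cadjoint U) else 0)"

lemma entry_monomial_eq: "entry_monomial a A = (\<Prod>p\<in>UNIV. (A $ fst p $ snd p) ^ a p)"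
  by (simp add: entry_monomial_def case_prod_beta)

lemma cadjoint_cadjoint [simp]: "cadjoint (cadjoint A) = A"
  by (simp add: cadjoint_def vec_eq_iff)

lemma entry_monomial_mult:
  "entry_monomial a A * entry_monomial b A = entry_monomial (\<lambda>p. a p + b p) A"
  by (simp add: entry_monomial_eq power_add prod.distrib)

text \<open>The conjugate of the entry of \<open>A\<close> at (i, j) is the entry of
  \<open>cadjoint A\<close> at (j, i), whence the swap of index pairs.\<close>

lemma cnj_entry_monomial:
  "cnj (entry_monomial a A) = entry_monomial (a \<circ> prod.swap) (cadjoint A)"
proof -
  have "entry_monomial (a \<circ> prod.swap) (cadjoint A) =
      (\<Prod>p\<in>UNIV. cnj (A $ fst (prod.swap p) $ snd (prod.swap p)) ^ a (prod.swap p))"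
    by (simp add: entry_monomial_eq cadjoint_def)
  also have "\<dots> = (\<Prod>p\<in>UNIV. cnj (A $ fst p $ snd p) ^ a p)"
    by (rule prod.reindex_bij_betw[OF bij_swap])
  finally show ?thesis
    by (simp add: entry_monomial_eq)
qed

lemma exponents_add:
  "a \<in> exponents r \<Longrightarrow> b \<in> exponents s \<Longrightarrow> (\<lambda>p. a p + b p) \<in> exponents (r + s)"
  by (simp add: exponents_def sum.distrib)

lemma exponents_swap:
  assumes "a \<in> exponents r"
  shows "a \<circ> prod.swap \<in> exponents r"
  using assms sum.reindex_bij_betw[OF bij_swap, of a] by (simp add: exponents_def)

lemma unitary_monomial_mult:
  "unitary_monomial a b U * unitary_monomial a' b' U =
     unitary_monomial (\<lambda>p. a p + a' p) (\<lambda>p. b p + b' p) U"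
  by (simp add: unitary_monomial_def entry_monomial_mult[symmetric])

lemma cnj_unitary_monomial:
  "cnj (unitary_monomial a b U) = unitary_monomial (b \<circ> prod.swap) (a \<circ> prod.swap) U"
  by (simp add: unitary_monomial_def cnj_entry_monomial)

lemma unitary_monomial_in_Hom:
  fixes a b :: "'n::finite \<times> 'n \<Rightarrow> nat"
  assumes "a \<in> exponents r" "b \<in> exponents s"
  shows "unitary_monomial a b \<in> unitary_Hom r s"
proof -
  \<comment> \<open>The coefficients single out one pair of exponents; the nested conditionals let
    the inner and the outer sum collapse in turn.\<close>
  define c :: "('n \<times> 'n \<Rightarrow> nat) \<Rightarrow> ('n \<times> 'n \<Rightarrow> nat) \<Rightarrow> complex"
    where "c a' b' = (if a' = a then if b' = b then 1 else 0 else 0)" for a' b'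
  have "(\<Sum>a'\<in>exponents r. \<Sum>b'\<in>exponents s.
      c a' b' * entry_monomial a' U * entry_monomial b' (cadjoint U)) =
      entry_monomial a U * entry_monomial b (cadjoint U)" for U
  proof -
    have "(\<Sum>b'\<in>exponents s. c a' b' * entry_monomial a' U * entry_monomial b' (cadjoint U)) =
        (if a' = a then entry_monomial a U * entry_monomial b (cadjoint U) else 0)" for a'
      using assms(2) by (simp add: c_def if_distrib[of "\<lambda>x. x * _"] finite_exponents cong: if_cong)
    then show ?thesis
      using assms(1) by (simp add: finite_exponents)
  qed
  then show ?thesis
    unfolding unitary_Hom_def unitary_monomial_def by (auto intro!: exI[of _ c])
qed

lemma sum_fun_apply: "sum F A x = (\<Sum>a\<in>A. F a x)"
  by (induction A rule: infinite_finite_induct) auto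

lemma unitary_Hom_eq_span:
  "unitary_Hom r s = cfun.span (case_prod unitary_monomial ` (exponents r \<times> exponents s))"
proof
  show "cfun.span (case_prod unitary_monomial ` (exponents r \<times> exponents s)) \<subseteq> unitary_Hom r s"
    by (intro cfun.span_minimal subspace_unitary_Hom) (auto intro: unitary_monomial_in_Hom)
  show "unitary_Hom r s \<subseteq> cfun.span (case_prod unitary_monomial ` (exponents r \<times> exponents s))"
  proof
    fix f :: "complex^'n^'n \<Rightarrow> complex" assume "f \<in> unitary_Hom r s"
    then obtain c where c: "\<And>U. f U = (if U \<in> unitary_group then \<Sum>a\<in>exponents r. \<Sum>b\<in>exponents s.
         c a b * entry_monomial a U * entry_monomial b (cadjoint U) else 0)"
      unfolding unitary_Hom_def by blast
    have "f = (\<Sum>a\<in>exponents r. \<Sum>b\<in>exponents s. cfun_scale (c a b) (unitary_monomial a b))"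
      by (rule ext) (simp add: c sum_fun_apply cfun_scale_def unitary_monomial_def mult.assoc)
    also have "\<dots> \<in> cfun.span (case_prod unitary_monomial ` (exponents r \<times> exponents s))"
      by (intro cfun.span_sum cfun.span_scale cfun.span_base) auto
    finally show "f \<in> cfun.span (case_prod unitary_monomial ` (exponents r \<times> exponents s))" .
  qed
qed

text \<open>Span induction for the generating monomials, phrased with pointwise operations so that
  linear claims about \<open>unitary_Hom\<close> reduce to single monomials.\<close>

lemma unitary_Hom_induct [consumes 1, case_names zero monomial add]:
  assumes "f \<in> unitary_Hom r s"
    and "P (\<lambda>_. 0)"
    and "\<And>k a b. a \<in> exponents r \<Longrightarrow> b \<in> exponents s \<Longrightarrow> P (\<lambda>U. k * unitary_monomial a b U)"
    and "\<And>g h. P g \<Longrightarrow> P h \<Longrightarrow> P (\<lambda>U. g U + h U)"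
  shows "P f"
  using assms(1) unfolding unitary_Hom_eq_span
proof (induction rule: cfun.span_induct_alt)
  case base
  then show ?case using assms(2) by (simp add: zero_fun_def)
next
  case (step k g h)
  then show ?case
    using assms(4)[OF assms(3)] by (auto simp: cfun_scale_def plus_fun_def)
qed

section \<open>Closure under linear combinations, conjugation and products\<close>

lemma unitary_Hom_scale: "f \<in> unitary_Hom r s \<Longrightarrow> (\<lambda>U. k * f U) \<in> unitary_Hom r s"
  using cfun.subspace_scale[OF subspace_unitary_Hom] by (fastforce simp: cfun_scale_def)

lemma unitary_Hom_add:
  "f \<in> unitary_Hom r s \<Longrightarrow> g \<in> unitary_Hom r s \<Longrightarrow> (\<lambda>U. f U + g U) \<in> unitary_Hom r s"
  using cfun.subspace_add[OF subspace_unitary_Hom] by (fastforce simp: plus_fun_def)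

lemma unitary_Hom_zero: "(\<lambda>_. 0) \<in> unitary_Hom r s"
  using cfun.subspace_0[OF subspace_unitary_Hom] by (simp add: zero_fun_def)

text \<open>Conjugation is additive and exchanges the roles of \<open>U\<close> and
  \<open>cadjoint U\<close> in a monomial, hence also the two degrees.\<close>

lemma unitary_Hom_cnj:
  assumes "f \<in> unitary_Hom r s"
  shows "(\<lambda>U. cnj (f U)) \<in> unitary_Hom s r"
  using assms
proof (induction rule: unitary_Hom_induct)
  case zero
  then show ?case by (simp add: unitary_Hom_zero)
next
  case (monomial k a b)
  then show ?case
    by (simp add: cnj_unitary_monomial unitary_Hom_scale unitary_monomial_in_Hom exponents_swap)
next
  case (add g h)
  then show ?case by (simp add: unitary_Hom_add)
qed

text \<open>By bilinearity it suffices to multiply two monomials, where exponents add; the induction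
  on \<open>g\<close> is nested in the monomial case for \<open>f\<close>.\<close>

lemma unitary_Hom_mult:
  assumes "f \<in> unitary_Hom r s" "g \<in> unitary_Hom r' s'"
  shows "(\<lambda>U. f U * g U) \<in> unitary_Hom (r + r') (s + s')"
  using assms(1)
proof (induction rule: unitary_Hom_induct)
  case zero
  then show ?case by (simp add: unitary_Hom_zero)
next
  case (monomial k a b)
  note ab = monomial
  show ?case
    using assms(2)
  proof (induction rule: unitary_Hom_induct)
    case zero
    then show ?case by (simp add: unitary_Hom_zero)
  next
    case (monomial l a' b')
    have "(\<lambda>U. (k * l) * (unitary_monomial a b U * unitary_monomial a' b' U))
        \<in> unitary_Hom (r + r') (s + s')"
      unfolding unitary_monomial_mult using ab monomial
      by (intro unitary_Hom_scale unitary_monomial_in_Hom exponents_add)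
    then show ?case by (simp add: mult_ac)
  next
    case (add g h)
    then show ?case by (simp add: distrib_left unitary_Hom_add)
  qed
next
  case (add g h)
  then show ?case by (simp add: distrib_right unitary_Hom_add)
qed

section \<open>Haar integrals\<close>

text \<open>Each row of a unitary matrix has Euclidean norm one, as the diagonal of
  \<open>U ** cadjoint U\<close> shows.\<close>

lemma unitary_entry_bounded:
  assumes "U \<in> unitary_group"
  shows "cmod (U $ i $ j) \<le> 1"
proof -
  have "(U ** cadjoint U) $ i $ i = 1"
    using assms by (simp add: unitary_group_def mat_def)
  then have "(\<Sum>k\<in>UNIV. U $ i $ k * cnj (U $ i $ k)) = 1"
    by (simp add: matrix_matrix_mult_def cadjoint_def)
  then have "complex_of_real (\<Sum>k\<in>UNIV. (cmod (U $ i $ k))\<^sup>2) = of_real 1"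
    by (simp add: complex_norm_square del: of_real_power)
  then have "(\<Sum>k\<in>UNIV. (cmod (U $ i $ k))\<^sup>2) = 1"
    by (simp only: of_real_eq_iff)
  then have "(cmod (U $ i $ j))\<^sup>2 \<le> 1"
    using member_le_sum[of j UNIV "\<lambda>k. (cmod (U $ i $ k))\<^sup>2"] by simp
  then show ?thesis
    by (simp add: power2_le_iff_abs_le abs_square_le_1)
qed

lemma cadjoint_unitary: "U \<in> unitary_group \<Longrightarrow> cadjoint U \<in> unitary_group"
  by (simp add: unitary_group_def)

lemma cadjoint_mult: "cadjoint (A ** B) = cadjoint B ** cadjoint A"
  by (simp add: cadjoint_def matrix_matrix_mult_def vec_eq_iff mult.commute)

lemma unitary_mult:
  assumes "U \<in> unitary_group" "V \<in> unitary_group"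
  shows "U ** V \<in> unitary_group"
proof -
  have "(U ** V) ** cadjoint (U ** V) = U ** (V ** cadjoint V) ** cadjoint U"
    by (simp add: cadjoint_mult matrix_mul_assoc)
  moreover have "cadjoint (U ** V) ** (U ** V) = cadjoint V ** (cadjoint U ** U) ** V"
    by (simp add: cadjoint_mult matrix_mul_assoc)
  ultimately show ?thesis
    using assms by (simp add: unitary_group_def)
qed

lemma norm_entry_monomial_le:
  assumes "U \<in> unitary_group"
  shows "cmod (entry_monomial a U) \<le> 1"
  unfolding entry_monomial_eq prod_norm[symmetric] norm_power
  by (intro prod_le_1 conjI power_le_one unitary_entry_bounded assms) auto

lemma norm_unitary_monomial_le: "cmod (unitary_monomial a b U) \<le> 1"
  by (simp add: unitary_monomial_def norm_mult mult_le_one norm_entry_monomial_le cadjoint_unitary)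

lemma continuous_on_unitary_monomial: "continuous_on unitary_group (unitary_monomial a b)"
proof -
  have "continuous_on unitary_group
      (\<lambda>U. entry_monomial a U * entry_monomial b (cadjoint U))"
    by (simp add: entry_monomial_eq cadjoint_def) (intro continuous_intros)
  then show ?thesis
    by (rule continuous_on_eq) (simp add: unitary_monomial_def)
qed

lemma continuous_on_unitary_Hom:
  assumes "f \<in> unitary_Hom r s"
  shows "continuous_on unitary_group f"
  using assms
  by (induction rule: unitary_Hom_induct) (auto intro!: continuous_intros continuous_on_unitary_monomial)

lemma normalized_haarD:
  assumes "normalized_haar \<mu>"
  shows "space \<mu> = unitary_group" "sets \<mu> = sets (restrict_space borel unitary_group)"
    "emeasure \<mu> unitary_group = 1" "\<And>V. V \<in> unitary_group \<Longrightarrow> distr \<mu> \<mu> (\<lambda>U. V ** U) = \<mu>"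
  using assms unfolding normalized_haar_def by auto

lemma measurable_haar_continuous:
  assumes "normalized_haar \<mu>" "continuous_on unitary_group f"
  shows "f \<in> borel_measurable \<mu>"
  using borel_measurable_continuous_on_restrict[OF assms(2)]
    measurable_cong_sets[OF normalized_haarD(2)[OF assms(1)] refl] by blast

text \<open>Monomials are measurable by continuity on the group and bounded by 1, and the measure is
  finite.\<close>

lemma integrable_unitary_Hom:
  assumes "normalized_haar \<mu>" "f \<in> unitary_Hom r s"
  shows "integrable \<mu> f"
  using assms(2)
proof (induction rule: unitary_Hom_induct)
  case (monomial k a b)
  interpret finite_measure \<mu>
    using normalized_haarD[OF assms(1)] by (intro finite_measureI) simp
  have "integrable \<mu> (unitary_monomial a b)"
    by (rule integrable_const_bound[of _ 1])
      (auto intro: norm_unitary_monomial_le measurable_haar_continuous[OF assms(1)]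
        continuous_on_unitary_monomial)
  then show ?case by simp
qed auto

text \<open>If the set were null, so would be all its left translates; countably many of these cover
  the group, which has measure 1.\<close>

lemma emeasure_haar_open_pos:
  fixes \<mu> :: "(complex^'n^'n) measure"
  assumes haar: "normalized_haar \<mu>" and "open S" and U0: "U0 \<in> S" "U0 \<in> unitary_group"
  shows "emeasure \<mu> (S \<inter> unitary_group) \<noteq> 0"
proof
  assume zero: "emeasure \<mu> (S \<inter> unitary_group) = 0"
  note \<mu> = normalized_haarD[OF haar]
  have sets_open: "T \<inter> unitary_group \<in> sets \<mu>" if "open T" for T
    using that unfolding \<mu>(2) by (auto simp: sets_restrict_space)
  define h where "h V A = (U0 ** cadjoint V) ** A" for V A :: "complex^'n^'n"
  have cont: "continuous_on B (h V)" for B V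
    unfolding h_def matrix_matrix_mult_def by (intro continuous_intros)
  have h_unitary: "U0 ** cadjoint V \<in> unitary_group" if "V \<in> unitary_group" for V
    using that U0 by (simp add: unitary_mult cadjoint_unitary)
  have null: "h V -` S \<inter> unitary_group \<in> null_sets \<mu>" if V: "V \<in> unitary_group" for V
  proof (rule null_setsI)
    have "open (h V -` S)"
      by (rule open_vimage[OF \<open>open S\<close> cont])
    then show "h V -` S \<inter> unitary_group \<in> sets \<mu>"
      by (rule sets_open)
    have "h V \<in> measurable \<mu> (restrict_space borel unitary_group)"
      using V by (intro measurable_restrict_space2 measurable_haar_continuous haar cont)
        (auto simp: \<mu>(1) h_def intro!: unitary_mult h_unitary)
    then have meas: "h V \<in> measurable \<mu> \<mu>"
      using measurable_cong_sets[OF refl \<mu>(2)] by blast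
    \<comment> \<open>Since \<open>h V\<close> maps the group into itself, \<open>S\<close> may be
      cut down to the group; invariance then gives the preimage the measure of
      \<open>S \<inter> unitary_group\<close>.\<close>
    have "emeasure \<mu> (h V -` S \<inter> unitary_group)
        = emeasure \<mu> (h V -` (S \<inter> unitary_group) \<inter> space \<mu>)"
      using V by (intro arg_cong[of _ _ "emeasure \<mu>"])
        (auto simp: \<mu>(1) h_def intro!: unitary_mult h_unitary)
    also have "\<dots> = emeasure (distr \<mu> \<mu> (h V)) (S \<inter> unitary_group)"
      using emeasure_distr[OF meas sets_open[OF \<open>open S\<close>]] by simp
    also have "distr \<mu> \<mu> (h V) = \<mu>"
      using \<mu>(4)[OF h_unitary[OF V]] by (simp add: h_def[abs_def])
    finally show "emeasure \<mu> (h V -` S \<inter> unitary_group) = 0"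
      using zero by simp
  qed
  define \<T> where "\<T> = (\<lambda>V. h V -` S) ` unitary_group"
  have "\<And>T. T \<in> \<T> \<Longrightarrow> open T"
    using open_vimage[OF \<open>open S\<close> cont] by (auto simp: \<T>_def)
  \<comment> \<open>A countable subcover suffices, because null sets are closed under countable
    unions.\<close>
  then obtain \<T>' where \<T>': "\<T>' \<subseteq> \<T>" "countable \<T>'" "\<Union>\<T>' = \<Union>\<T>"
    using Lindelof[of \<T>] by blast
  have "V \<in> h V -` S" if "V \<in> unitary_group" for V
  proof -
    have "h V V = U0 ** (cadjoint V ** V)"
      by (simp add: h_def matrix_mul_assoc)
    then show ?thesis
      using that U0 by (simp add: unitary_group_def)
  qed
  then have "unitary_group = (\<Union>T\<in>\<T>'. T \<inter> unitary_group)"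
    using \<T>'(3) by (auto simp: \<T>_def)
  moreover have "(\<Union>T\<in>\<T>'. T \<inter> unitary_group) \<in> null_sets \<mu>"
    using \<T>'(1) null by (intro null_sets_UN' \<T>'(2)) (auto simp: \<T>_def)
  ultimately show False
    using \<mu>(3) by auto
qed

text \<open>The set where \<open>f\<close> is nonzero is relatively open in the group and null,
  hence empty by \<open>emeasure_haar_open_pos\<close>.\<close>

lemma AE_haar_zero_continuous:
  fixes f :: "complex^'n^'n \<Rightarrow> complex"
  assumes "normalized_haar \<mu>" "continuous_on unitary_group f" "AE U in \<mu>. f U = 0"
    and "U0 \<in> unitary_group"
  shows "f U0 = 0"
proof (rule ccontr)
  assume "f U0 \<noteq> 0"
  obtain S where S: "open S" "S \<inter> unitary_group = f -` (- {0}) \<inter> unitary_group"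
    using assms(2) continuous_on_open_invariant[of unitary_group f]
    by (meson open_Compl closed_singleton)
  have "emeasure \<mu> {U \<in> space \<mu>. f U \<noteq> 0} = 0"
    using assms(3) measurable_haar_continuous[OF assms(1,2)]
    by (subst (asm) AE_iff_measurable[OF _ refl]) auto
  also have "{U \<in> space \<mu>. f U \<noteq> 0} = S \<inter> unitary_group"
    using S(2) by (auto simp: normalized_haarD(1)[OF assms(1)])
  finally show False
    using emeasure_haar_open_pos[OF assms(1) S(1), of U0] S(2) assms(4) \<open>f U0 \<noteq> 0\<close> by blast
qed

section \<open>Averages over a design\<close>

lemma prod_list_map_eq_prod_count:
  fixes g :: "'a::finite \<Rightarrow> 'b::comm_monoid_mult"
  shows "prod_list (map g xs) = (\<Prod>x\<in>UNIV. g x ^ count_list xs x)"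
proof (induction xs)
  case (Cons y ys)
  have "(\<Prod>x\<in>UNIV. g x ^ count_list (y # ys) x) =
      (\<Prod>x\<in>UNIV. (if x = y then g x else 1) * g x ^ count_list ys x)"
    by (intro prod.cong) auto
  then show ?case
    using Cons by (simp add: prod.distrib)
qed simp

lemma obtain_list_with_counts:
  fixes a :: "'a::finite \<Rightarrow> nat"
  assumes "sum a UNIV = n"
  obtains xs where "length xs = n" "count_list xs = a"
proof -
  have "\<exists>xs. length xs = n \<and> count_list xs = a"
    using assms
  proof (induction n arbitrary: a)
    case 0
    then show ?case by (intro exI[of _ "[]"]) auto
  next
    case (Suc n)
    then have "sum a UNIV \<noteq> 0" by simp
    then obtain y where y: "a y > 0" by (auto simp: sum_eq_0_iff)
    \<comment> \<open>Lower the multiplicity of some \<open>y\<close> by one, which is possible as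
      \<open>a y > 0\<close>; the list found for the rest then receives \<open>y\<close> as
      head.\<close>
    have "sum a UNIV = sum (\<lambda>x. (a(y := a y - 1)) x + (if x = y then 1 else 0)) UNIV"
      using y by (intro sum.cong) auto
    then have "sum (a(y := a y - 1)) UNIV = n"
      using Suc.prems by (simp only: sum.distrib) simp
    then obtain xs where "length xs = n" "count_list xs = a(y := a y - 1)"
      using Suc.IH by blast
    then show ?case
      using y by (intro exI[of _ "y # xs"]) (auto simp: fun_eq_iff)
  qed
  then show ?thesis using that by blast
qed

text \<open>A monomial of degree \<open>t\<close> is a product of \<open>t\<close> matrix entries
  listed with multiplicity; \<open>I\<close> collects their row indices and \<open>J\<close> their
  column indices.\<close>

lemma entry_monomial_as_tensor_power:
  assumes "a \<in> exponents t"
  obtains I J where "I \<in> tensor_index t" "J \<in> tensor_index t"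
    "\<And>A. entry_monomial a A = tensor_power t A I J"
proof -
  obtain xs where xs: "length xs = t" "count_list xs = a"
    using assms obtain_list_with_counts[of a t] by (auto simp: exponents_def)
  have "entry_monomial a A = tensor_power t A (map fst xs) (map snd xs)" for A
  proof -
    have "entry_monomial a A = prod_list (map (\<lambda>p. A $ fst p $ snd p) xs)"
      by (simp add: entry_monomial_eq prod_list_map_eq_prod_count xs)
    also have "\<dots> = (\<Prod>k<t. A $ fst (xs ! k) $ snd (xs ! k))"
      by (simp add: prod.list_conv_set_nth xs atLeast0LessThan)
    finally show ?thesis
      by (simp add: tensor_power_def xs)
  qed
  then show ?thesis
    using that[of "map fst xs" "map snd xs"] xs by (simp add: tensor_index_def)
qed

text \<open>Both sides are linear in \<open>f\<close>, and for a monomial the claim is one entry of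
  the design equation. Integrability is carried along because the integral of a sum is split in the
  additive case.\<close>

lemma design_average:
  assumes haar: "normalized_haar \<mu>" and design: "unitary_design \<mu> t X"
    and "f \<in> unitary_Hom t t"
  shows "1 / of_nat (card X) * (\<Sum>U\<in>X. f U) = (\<integral>U. f U \<partial>\<mu>) \<and> integrable \<mu> f"
  using assms(3)
proof (induction rule: unitary_Hom_induct)
  case (monomial k a b)
  obtain I J where IJ: "I \<in> tensor_index t" "J \<in> tensor_index t"
    "\<And>A. entry_monomial a A = tensor_power t A I J"
    using entry_monomial_as_tensor_power[OF monomial(1)] by blast
  obtain K L where KL: "K \<in> tensor_index t" "L \<in> tensor_index t"
    "\<And>A. entry_monomial b A = tensor_power t A K L"
    using entry_monomial_as_tensor_power[OF monomial(2)] by blast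
  \<comment> \<open>Restricted to the group, since \<open>unitary_monomial\<close> is set to zero
    elsewhere. This is enough: \<open>X\<close> lies in the group and the group is the space of
    \<open>\<mu>\<close>.\<close>
  have eq: "unitary_monomial a b U =
      tensor_prod (tensor_power t U) (tensor_power t (cadjoint U)) (I, K) (J, L)"
    if "U \<in> unitary_group" for U
    using that by (simp add: unitary_monomial_def tensor_prod_def IJ KL)
  have "X \<subseteq> unitary_group"
    using design by (simp add: unitary_design_def)
  then have "1 / of_nat (card X) * (\<Sum>U\<in>X. unitary_monomial a b U) =
     1 / of_nat (card X) *
        (\<Sum>U\<in>X. tensor_prod (tensor_power t U) (tensor_power t (cadjoint U)) (I, K) (J, L))"
    by (intro arg_cong2[of _ _ _ _ "(*)"] sum.cong refl eq) auto
  also have "\<dots> = (\<integral>U. tensor_prod (tensor_power t U) (tensor_power t (cadjoint U)) (I, K) (J, L) \<partial>\<mu>)"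
    using design IJ KL unfolding unitary_design_def by blast
  also have "\<dots> = (\<integral>U. unitary_monomial a b U \<partial>\<mu>)"
    by (intro Bochner_Integration.integral_cong refl eq[symmetric])
      (simp add: normalized_haarD(1)[OF haar])
  finally have "1 / of_nat (card X) * (\<Sum>U\<in>X. unitary_monomial a b U) =
      (\<integral>U. unitary_monomial a b U \<partial>\<mu>)" .
  from arg_cong[OF this, of "(*) k"]
  have "1 / of_nat (card X) * (\<Sum>U\<in>X. k * unitary_monomial a b U) =
      (\<integral>U. k * unitary_monomial a b U \<partial>\<mu>)"
    by (simp add: sum_distrib_left[symmetric])
  moreover have "integrable \<mu> (\<lambda>U. k * unitary_monomial a b U)"
    using monomial by (intro integrable_unitary_Hom[OF haar] unitary_Hom_scale unitary_monomial_in_Hom)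
  ultimately show ?case by blast
next
  case (add g h)
  then show ?case by (simp add: sum.distrib distrib_left)
qed auto

lemma unitary_Hom_zero_if_zero_on_design:
  assumes haar: "normalized_haar \<mu>" and design: "unitary_design \<mu> (r + s) X"
    and f: "f \<in> unitary_Hom r s" and zero: "\<And>U. U \<in> X \<Longrightarrow> f U = 0"
  shows "f = 0"
proof -
  \<comment> \<open>Conjugation turns degrees (r, s) into (s, r), so the product has degree
    \<open>r + s\<close> in both arguments, as the design property requires.\<close>
  have "(\<lambda>U. f U * cnj (f U)) \<in> unitary_Hom (r + s) (r + s)"
    using unitary_Hom_mult[OF f unitary_Hom_cnj[OF f]] by (simp add: add.commute)
  from design_average[OF haar design this]
  have "(\<integral>U. f U * cnj (f U) \<partial>\<mu>) = 0" "integrable \<mu> (\<lambda>U. f U * cnj (f U))"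
    using zero by auto
  \<comment> \<open>The complex integral is read as a real one, to which the vanishing criterion for
    nonnegative functions applies.\<close>
  then have int0: "(\<integral>U. (cmod (f U))\<^sup>2 \<partial>\<mu>) = 0"
    and "integrable \<mu> (\<lambda>U. complex_of_real ((cmod (f U))\<^sup>2))"
    by (simp_all add: complex_norm_square[symmetric] del: of_real_power)
  then have int: "integrable \<mu> (\<lambda>U. (cmod (f U))\<^sup>2)"
    using integrable_Re by fastforce
  have "AE U in \<mu>. (cmod (f U))\<^sup>2 = 0"
    using int0 by (subst (asm) integral_nonneg_eq_0_iff_AE[OF int]) auto
  then have "AE U in \<mu>. f U = 0"
    by simp
  then have "f U = 0" if "U \<in> unitary_group" for U
    using AE_haar_zero_continuous[OF haar continuous_on_unitary_Hom[OF f]] that by blast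
  moreover have "f U = 0" if "U \<notin> unitary_group" for U
    using f that by (auto simp: unitary_Hom_def)
  ultimately show ?thesis
    by (auto simp: fun_eq_iff)
qed

section \<open>Dimension bound\<close>

interpretation cfun_pair: vector_space_pair cfun_scale cfun_scale ..

text \<open>Restriction to \<open>X\<close> is linear and injective on \<open>V\<close>, and its
  image lies in the span of the at most \<open>card X\<close> point indicators.\<close>

lemma cfun_dim_le_card:
  assumes V: "cfun.subspace V" and "finite X"
    and inj: "\<And>f. f \<in> V \<Longrightarrow> (\<And>x. x \<in> X \<Longrightarrow> f x = 0) \<Longrightarrow> f = 0"
  shows "cfun.dim V \<le> card X"
proof -
  \<comment> \<open>A restricted function is extended by zero, so that \<open>L\<close> stays within
    one vector space.\<close>
  define L :: "('a \<Rightarrow> complex) \<Rightarrow> 'a \<Rightarrow> complex" where "L f = (\<lambda>x. if x \<in> X then f x else 0)" for f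
  interpret L: Vector_Spaces.linear cfun_scale cfun_scale L
    by unfold_locales (auto simp: L_def cfun_scale_def)
  define D where "D = (\<lambda>x y. if y = x then 1 else 0 :: complex) ` X"
  have "card D \<le> card X" "finite D"
    unfolding D_def using \<open>finite X\<close> by (auto intro: card_image_le)
  have L_span: "L f \<in> cfun.span D" for f
  proof -
    have "L f = (\<Sum>x\<in>X. cfun_scale (f x) (\<lambda>y. if y = x then 1 else 0))"
      using \<open>finite X\<close>
      by (auto simp: fun_eq_iff L_def sum_fun_apply cfun_scale_def if_distrib[of "(*) _"] cong: if_cong)
    also have "\<dots> \<in> cfun.span D"
      unfolding D_def by (intro cfun.span_sum cfun.span_scale cfun.span_base imageI)
    finally show ?thesis .
  qed
  obtain B where B: "B \<subseteq> V" "cfun.independent B" "V \<subseteq> cfun.span B" "card B = cfun.dim V"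
    by (rule cfun.basis_exists)
  have "cfun.span B \<subseteq> V"
    using B(1) V by (rule cfun.span_minimal)
  have L_inj: "inj_on L (cfun.span B)"
  proof (rule L.inj_on_iff_eq_0[THEN iffD2])
    show "cfun.subspace (cfun.span B)" by simp
    show "\<forall>f\<in>cfun.span B. L f = 0 \<longrightarrow> f = 0"
      using \<open>cfun.span B \<subseteq> V\<close> inj by (auto simp: L_def fun_eq_iff)
  qed
  have "cfun.independent (L ` B)"
    using L.independent_injective_image[OF B(2) L_inj] .
  then have "card (L ` B) \<le> card D"
    using cfun.independent_span_bound[OF \<open>finite D\<close>] L_span by blast
  moreover have "card (L ` B) = card B"
    using inj_on_subset[OF L_inj cfun.span_superset] by (rule card_image)
  ultimately show ?thesis
    using B(4) \<open>card D \<le> card X\<close> by simp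
qed

theorem theorem3p1:
  fixes \<mu> :: "(complex^'n^'n) measure" and X :: "(complex^'n^'n) set" and t :: nat
  assumes "t > 0"
    and "normalized_haar \<mu>"
    and "unitary_design \<mu> t X"
  shows "card X \<ge> cfun.dim (unitary_Hom (nat \<lceil>real t / 2\<rceil>) (nat \<lfloor>real t / 2\<rfloor>)
                      :: (complex^'n^'n \<Rightarrow> complex) set)"
proof -
  have "nat \<lceil>real t / 2\<rceil> + nat \<lfloor>real t / 2\<rfloor> = t"
    by linarith
  \<comment> \<open>The strength of the design is rewritten as the sum of the two degrees, the form
    in which vanishing on \<open>X\<close> forces vanishing.\<close>
  then have "unitary_design \<mu> (nat \<lceil>real t / 2\<rceil> + nat \<lfloor>real t / 2\<rfloor>) X"
    using assms(3) by simp
  moreover have "finite X"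
    using assms(3) by (simp add: unitary_design_def)
  ultimately show ?thesis
    by (intro cfun_dim_le_card subspace_unitary_Hom)
      (auto intro: unitary_Hom_zero_if_zero_on_design[OF assms(2)])
qed

end
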